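(* Let $\{X_n\}_{n\ge 0}$ be a finite irreducible discrete time Markov chain with state space $\mathcal S=\{1,\dots,m\}$ and stationary distribution $\{\pi_j\}$. If $m_{ij}$ denotes the mean first passage time from state $i$ to state $j$, then for every $i\in\mathcal S$ the mixing times starting in state $i$ satisfy $$E[T_i^{(0)}]=\sum_{j\ne i}\pi_jm_{ij},\qquad E[T_i^{(1)}]=\sum_j\pi_jm_{ij}.$$
   Context: The mixing variable $M$ is a random variable, independent of the chain, with $P[M=j]=\pi_j$ for all $j\in\mathcal S$. Given $X_0=i$, $T_i^{(0)}=\min\{n\ge 0: X_n=M\}$ and $T_i^{(1)}=\min\{n\ge 1: X_n=M\}$. The first passage time from $i$ to $j$ is $T_{ij}=\min\{n\ge1: X_n=j\}$ given $X_0=i$, and $m_{ij}=E[T_{ij}\mid X_0=i]$ (so $m_{ii}$ is the mean recurrence time of state $i$). *)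

theory Defs
  imports "HOL-Probability.Probability"
begin

primrec n_step :: "'s set \<Rightarrow> ('s \<Rightarrow> 's \<Rightarrow> real) \<Rightarrow> nat \<Rightarrow> 's \<Rightarrow> 's \<Rightarrow> real" where
  "n_step S P 0 i j = (if i = j then 1 else 0)"
| "n_step S P (Suc n) i j = (\<Sum>k\<in>S. P i k * n_step S P n k j)"

definition irreducible_on :: "'s set \<Rightarrow> ('s \<Rightarrow> 's \<Rightarrow> real) \<Rightarrow> bool" where
  "irreducible_on S P \<longleftrightarrow> (\<forall>i\<in>S. \<forall>j\<in>S. \<exists>n. n_step S P n i j > 0)"

definition stationary_distribution :: "'s set \<Rightarrow> ('s \<Rightarrow> 's \<Rightarrow> real) \<Rightarrow> ('s \<Rightarrow> real) \<Rightarrow> bool" where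
  "stationary_distribution S P \<pi> \<longleftrightarrow>
     (\<forall>j\<in>S. 0 \<le> \<pi> j) \<and> (\<Sum>j\<in>S. \<pi> j) = 1 \<and> (\<forall>j\<in>S. (\<Sum>i\<in>S. \<pi> i * P i j) = \<pi> j)"

text \<open>
  Time-homogeneous chain with an arbitrary initial distribution, on a probability space
  that may carry further random variables. The Markov property is the elementary one,
  required only for histories of positive probability.
\<close>

locale finite_markov_chain = prob_space M
  for M :: "'w measure" +
  fixes S :: "'s set" and P :: "'s \<Rightarrow> 's \<Rightarrow> real" and X :: "nat \<Rightarrow> 'w \<Rightarrow> 's"
  assumes finite_states: "finite S"
    and transition_nonneg: "\<And>i j. i \<in> S \<Longrightarrow> j \<in> S \<Longrightarrow> 0 \<le> P i j"
    and transition_sum: "\<And>i. i \<in> S \<Longrightarrow> (\<Sum>j\<in>S. P i j) = 1"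
    and measurable_chain: "\<And>n. X n \<in> measurable M (count_space S)"
    and markov: "\<And>n x j. \<lbrakk>\<forall>k\<le>n. x k \<in> S; j \<in> S; \<P>(\<omega> in M. \<forall>k\<le>n. X k \<omega> = x k) > 0\<rbrakk>
      \<Longrightarrow> \<P>(\<omega> in M. X (Suc n) \<omega> = j \<bar> \<forall>k\<le>n. X k \<omega> = x k) = P (x n) j"

text \<open>
  Independence of \<open>Y\<close> from the whole sequence is stated on the generated sigma-algebras,
  because \<^const>\<open>prob_space.indep_var\<close> requires both variables to have the same type.
\<close>

definition mixing_variable ::
  "'w measure \<Rightarrow> 's set \<Rightarrow> ('s \<Rightarrow> real) \<Rightarrow> (nat \<Rightarrow> 'w \<Rightarrow> 's) \<Rightarrow> ('w \<Rightarrow> 's) \<Rightarrow> bool" where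
  "mixing_variable M S \<pi> X Y \<longleftrightarrow>
     Y \<in> measurable M (count_space S) \<and>
     (\<forall>j\<in>S. \<P>(\<omega> in M. Y \<omega> = j) = \<pi> j) \<and>
     prob_space.indep_set M
       (sets (vimage_algebra (space M) Y (count_space S)))
       (sets (vimage_algebra (space M) (\<lambda>\<omega> n. X n \<omega>) (\<Pi>\<^sub>M n\<in>UNIV. count_space S)))"

text \<open>Times that never occur take the value \<open>\<infinity>\<close>, the infimum of the empty set.\<close>

definition first_passage_time :: "(nat \<Rightarrow> 'w \<Rightarrow> 's) \<Rightarrow> 's \<Rightarrow> 'w \<Rightarrow> enat" where
  "first_passage_time X j \<omega> = Inf {enat n | n. 1 \<le> n \<and> X n \<omega> = j}"

definition mixing_time :: "nat \<Rightarrow> (nat \<Rightarrow> 'w \<Rightarrow> 's) \<Rightarrow> ('w \<Rightarrow> 's) \<Rightarrow> 'w \<Rightarrow> enat" where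
  "mixing_time r X Y \<omega> = Inf {enat n | n. r \<le> n \<and> X n \<omega> = Y \<omega>}"

text \<open>
  The elementary conditional expectation of \<open>T\<close> given \<open>X 0 = i\<close>; it is meaningful only if
  this event has positive probability.
\<close>

definition expected_time_from ::
  "'w measure \<Rightarrow> (nat \<Rightarrow> 'w \<Rightarrow> 's) \<Rightarrow> 's \<Rightarrow> ('w \<Rightarrow> enat) \<Rightarrow> ennreal" where
  "expected_time_from M X i T =
     (\<integral>\<^sup>+ \<omega>. ennreal_of_enat (T \<omega>) \<partial>uniform_measure M {\<omega> \<in> space M. X 0 \<omega> = i})"

definition mean_first_passage :: "'w measure \<Rightarrow> (nat \<Rightarrow> 'w \<Rightarrow> 's) \<Rightarrow> 's \<Rightarrow> 's \<Rightarrow> ennreal" where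
  "mean_first_passage M X i j = expected_time_from M X i (first_passage_time X j)"

end

(* On the event Y = j the mixing time is the hitting time of j, which is a function of the path X
   alone and so independent of that event; summing over j gives the average of the mean hitting
   times with weights pi j. Starting in i, the hitting time of j counted from step 0 vanishes for
   j = i and is the first passage time otherwise. *)
theory Submission
  imports Defs
begin

text \<open>Independence of \<open>B\<close> from \<open>Z\<close> means that the law of
  \<open>Z\<close> under \<open>M\<close> restricted to \<open>B\<close> is the law of
  \<open>Z\<close> scaled by the mass of \<open>B\<close>; integrating \<open>g\<close> against both
  laws gives the claim. A single event \<open>B\<close> suffices here, so no second random variable
  of matching type has to be introduced.\<close>

lemma (in prob_space) nn_integral_indep_indicator:
  assumes Z [measurable]: "Z \<in> measurable M N" and B [measurable]: "B \<in> events"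
    and indep: "\<And>A. A \<in> sets N \<Longrightarrow> prob (B \<inter> (Z -` A \<inter> space M)) = prob B * prob (Z -` A \<inter> space M)"
    and g [measurable]: "g \<in> borel_measurable N"
  shows "(\<integral>\<^sup>+\<omega>. g (Z \<omega>) * indicator B \<omega> \<partial>M) = emeasure M B * (\<integral>\<^sup>+\<omega>. g (Z \<omega>) \<partial>M)"
proof -
  have "distr (density M (indicator B)) N Z = scale_measure (emeasure M B) (distr M N Z)"
  proof (rule measure_eqI)
    fix A assume "A \<in> sets (distr (density M (indicator B)) N Z)"
    then have A: "A \<in> sets N" by simp
    then have ZA: "Z -` A \<inter> space M \<in> events" by simp
    have "emeasure (distr (density M (indicator B)) N Z) A = emeasure M (B \<inter> (Z -` A \<inter> space M))"
      using A ZA by (simp add: emeasure_distr emeasure_density nn_integral_set_ennreal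
          flip: indicator_inter_arith)
    also have "\<dots> = emeasure M B * emeasure M (Z -` A \<inter> space M)"
      using indep[OF A] by (simp add: emeasure_eq_measure ennreal_mult)
    finally show "emeasure (distr (density M (indicator B)) N Z) A
        = emeasure (scale_measure (emeasure M B) (distr M N Z)) A"
      using A by (simp add: emeasure_distr)
  qed simp
  then have "(\<integral>\<^sup>+z. g z \<partial>distr (density M (indicator B)) N Z)
      = emeasure M B * (\<integral>\<^sup>+z. g z \<partial>distr M N Z)"
    by (simp add: nn_integral_scale_measure)
  then show ?thesis
    by (simp add: nn_integral_distr nn_integral_density mult.commute)
qed

text \<open>Stated on the path space, with the coordinate maps as the chain, so that hitting a fixed
  target becomes a measurable functional of the path to which independence can be applied.\<close>

lemma measurable_mixing_time_const:
  "(\<lambda>z. mixing_time r (\<lambda>n z. z n) (\<lambda>_. j) z)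
     \<in> measurable (\<Pi>\<^sub>M n\<in>(UNIV :: nat set). count_space S) (count_space UNIV)"
proof -
  \<comment> \<open>The index set of the infimum depends on \<open>z\<close>. Letting every index
    that is not a hit contribute \<open>\<infinity>\<close> turns it into a countable infimum of
    measurable functions.\<close>
  have "mixing_time r (\<lambda>n z. z n) (\<lambda>_. j) z
      = (INF n. if r \<le> n \<and> z n = j then enat n else \<infinity>)" for z :: "nat \<Rightarrow> 'a"
    unfolding mixing_time_def
    by (intro antisym Inf_greatest INF_greatest) (auto intro: Inf_lower INF_lower2)
  then show ?thesis by (simp only:) measurable
qed

lemma first_passage_time_eq_mixing_time:
  "first_passage_time X j = mixing_time 1 X (\<lambda>_. j)"
  by (simp add: fun_eq_iff first_passage_time_def mixing_time_def)

lemma mixing_time_0_eq_mixing_time_1: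
  assumes "X 0 \<omega> \<noteq> Y \<omega>"
  shows "mixing_time 0 X Y \<omega> = mixing_time 1 X Y \<omega>"
proof -
  have "0 \<le> n \<and> X n \<omega> = Y \<omega> \<longleftrightarrow> 1 \<le> n \<and> X n \<omega> = Y \<omega>" for n
    using assms by (cases n) auto
  then show ?thesis by (simp only: mixing_time_def)
qed

lemma mixing_time_0_eq_0:
  assumes "X 0 \<omega> = Y \<omega>"
  shows "mixing_time 0 X Y \<omega> = 0"
proof -
  have "mixing_time 0 X Y \<omega> \<le> enat 0"
    unfolding mixing_time_def using assms by (auto intro: Inf_lower)
  then show ?thesis by (simp flip: zero_enat_def)
qed

text \<open>Reduces a random target to constant ones for every starting index \<open>r\<close> at
  once, so both formulas of the theorem come from the cases \<open>r = 0\<close> and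
  \<open>r = 1\<close>.\<close>

lemma (in prob_space) expected_mixing_time:
  assumes fin: "finite S" and X [measurable]: "\<And>n. X n \<in> measurable M (count_space S)"
    and mix: "mixing_variable M S \<pi> X Y"
  shows "expected_time_from M X i (mixing_time r X Y)
    = (\<Sum>j\<in>S. ennreal (\<pi> j) * expected_time_from M X i (mixing_time r X (\<lambda>_. j)))"
proof -
  let ?N = "\<Pi>\<^sub>M n\<in>(UNIV :: nat set). count_space S"
  let ?Z = "\<lambda>\<omega> n. X n \<omega>"
  let ?E = "{\<omega> \<in> space M. X 0 \<omega> = i}"
  let ?B = "\<lambda>j. {\<omega> \<in> space M. Y \<omega> = j}"
  let ?T = "\<lambda>j \<omega>. ennreal_of_enat (mixing_time r X (\<lambda>_. j) \<omega>)"
  \<comment> \<open>The conditioning event is built into the functional: it too depends only on the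
    path, so one use of independence handles the hitting time and the start in \<open>i\<close>
    together.\<close>
  let ?g = "\<lambda>j z. ennreal_of_enat (mixing_time r (\<lambda>n z. z n) (\<lambda>_. j) z)
    * indicator {z \<in> space ?N. z 0 = i} z"
  have Y [measurable]: "Y \<in> measurable M (count_space S)"
    and \<pi>: "\<And>j. j \<in> S \<Longrightarrow> prob (?B j) = \<pi> j"
    and ind: "indep_set (sets (vimage_algebra (space M) Y (count_space S)))
                (sets (vimage_algebra (space M) ?Z ?N))"
    using mix by (auto simp: mixing_variable_def)
  have Z [measurable]: "?Z \<in> measurable M ?N"
    by (rule measurable_PiM_single') (auto simp: space_PiM dest: measurable_space[OF X])
  have E [measurable]: "?E \<in> events" by measurable
  have B [measurable]: "?B j \<in> events" for j by measurable
  have g [measurable]: "?g j \<in> borel_measurable ?N" for j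
    by (intro borel_measurable_times_ennreal borel_measurable_indicator
        measurable_compose[OF measurable_mixing_time_const]) measurable
  have gZ: "?g j (?Z \<omega>) = ?T j \<omega> * indicator ?E \<omega>" if "\<omega> \<in> space M" for j \<omega>
    using that measurable_space[OF Z that]
    by (auto simp: mixing_time_def indicator_def)
  have T [measurable]: "?T j \<in> borel_measurable M" for j
  proof -
    have "mixing_time r X (\<lambda>_. j) \<in> measurable M (count_space UNIV)"
      using measurable_compose[OF Z measurable_mixing_time_const[of r j S]]
      by (simp add: mixing_time_def[abs_def])
    then show ?thesis by simp
  qed
  \<comment> \<open>Only the summand \<open>j = Y \<omega>\<close> survives. The others vanish even
    where a hitting time is infinite, since infinity times zero is zero in
    \<open>ennreal\<close>.\<close>
  have split: "ennreal_of_enat (mixing_time r X Y \<omega>) = (\<Sum>j\<in>S. ?T j \<omega> * indicator (?B j) \<omega>)"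
    if "\<omega> \<in> space M" for \<omega>
  proof -
    have "Y \<omega> \<in> S" using measurable_space[OF Y that] by simp
    then have "(\<Sum>j\<in>S. ?T j \<omega> * indicator (?B j) \<omega>) = (\<Sum>j\<in>{Y \<omega>}. ?T j \<omega> * indicator (?B j) \<omega>)"
      using fin by (intro sum.mono_neutral_right) auto
    then show ?thesis using that by (simp add: mixing_time_def)
  qed
  \<comment> \<open>With a moving target the time is no function of the path alone; its
    measurability comes from the finite sum in \<open>split\<close>.\<close>
  have YT: "(\<lambda>\<omega>. ennreal_of_enat (mixing_time r X Y \<omega>)) \<in> borel_measurable M"
    by (subst measurable_cong[OF split]) auto
  have indep: "(\<integral>\<^sup>+\<omega>. ?T j \<omega> * indicator ?E \<omega> * indicator (?B j) \<omega> \<partial>M)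
      = ennreal (\<pi> j) * (\<integral>\<^sup>+\<omega>. ?T j \<omega> * indicator ?E \<omega> \<partial>M)" if j: "j \<in> S" for j
  proof -
    have "?B j \<in> sets (vimage_algebra (space M) Y (count_space S))"
      using in_vimage_algebra[of "{j}" "count_space S" Y "space M"] j
      by (simp add: vimage_def Int_def conj_commute)
    then have "(\<integral>\<^sup>+\<omega>. ?g j (?Z \<omega>) * indicator (?B j) \<omega> \<partial>M)
        = emeasure M (?B j) * (\<integral>\<^sup>+\<omega>. ?g j (?Z \<omega>) \<partial>M)"
      by (intro nn_integral_indep_indicator[OF Z B _ g] indep_setD[OF ind] in_vimage_algebra)
    then show ?thesis
      using \<pi>[OF j] by (simp add: emeasure_eq_measure gZ cong: nn_integral_cong)
  qed
  have "expected_time_from M X i (mixing_time r X Y)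
      = (\<integral>\<^sup>+\<omega>. ennreal_of_enat (mixing_time r X Y \<omega>) * indicator ?E \<omega> \<partial>M) / emeasure M ?E"
    unfolding expected_time_from_def by (rule nn_integral_uniform_measure[OF YT E])
  also have "(\<integral>\<^sup>+\<omega>. ennreal_of_enat (mixing_time r X Y \<omega>) * indicator ?E \<omega> \<partial>M)
      = (\<integral>\<^sup>+\<omega>. (\<Sum>j\<in>S. ?T j \<omega> * indicator ?E \<omega> * indicator (?B j) \<omega>) \<partial>M)"
    by (intro nn_integral_cong) (simp add: split sum_distrib_left mult_ac)
  also have "\<dots> = (\<Sum>j\<in>S. ennreal (\<pi> j) * (\<integral>\<^sup>+\<omega>. ?T j \<omega> * indicator ?E \<omega> \<partial>M))"
    by (subst nn_integral_sum) (auto simp: indep)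
  also have "\<dots> / emeasure M ?E
      = (\<Sum>j\<in>S. ennreal (\<pi> j) * ((\<integral>\<^sup>+\<omega>. ?T j \<omega> * indicator ?E \<omega> \<partial>M) / emeasure M ?E))"
    by (simp add: divide_ennreal_def sum_distrib_right mult.assoc)
  also have "\<dots> = (\<Sum>j\<in>S. ennreal (\<pi> j) * expected_time_from M X i (mixing_time r X (\<lambda>_. j)))"
    unfolding expected_time_from_def by (simp add: nn_integral_uniform_measure[OF T E])
  finally show ?thesis .
qed

text \<open>The uniform measure is concentrated on the conditioning event, so values elsewhere do
  not matter.\<close>

lemma expected_time_from_cong:
  assumes "{\<omega> \<in> space M. X 0 \<omega> = i} \<in> sets M"
    and "\<And>\<omega>. \<omega> \<in> space M \<Longrightarrow> X 0 \<omega> = i \<Longrightarrow> T \<omega> = T' \<omega>"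
  shows "expected_time_from M X i T = expected_time_from M X i T'"
  unfolding expected_time_from_def
  by (intro nn_integral_cong_AE AE_uniform_measureI) (use assms in auto)

theorem theorem2p7:
  fixes M :: "'w measure" and m :: nat and P :: "nat \<Rightarrow> nat \<Rightarrow> real"
    and X :: "nat \<Rightarrow> 'w \<Rightarrow> nat" and \<pi> :: "nat \<Rightarrow> real" and Y :: "'w \<Rightarrow> nat" and i :: nat
  assumes "finite_markov_chain M {1..m} P X"
    and "irreducible_on {1..m} P"
    and "stationary_distribution {1..m} P \<pi>"
    and "mixing_variable M {1..m} \<pi> X Y"
    and "i \<in> {1..m}"
    and "\<P>(\<omega> in M. X 0 \<omega> = i) > 0"
  shows "expected_time_from M X i (mixing_time 0 X Y)
           = (\<Sum>j\<in>{1..m} - {i}. ennreal (\<pi> j) * mean_first_passage M X i j)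
       \<and> expected_time_from M X i (mixing_time 1 X Y)
           = (\<Sum>j\<in>{1..m}. ennreal (\<pi> j) * mean_first_passage M X i j)"
proof -
  interpret finite_markov_chain M "{1..m}" P X by fact
  note [measurable] = measurable_chain
  note mix = expected_mixing_time[OF finite_states measurable_chain assms(4)]
  have E: "{\<omega> \<in> space M. X 0 \<omega> = i} \<in> events" by measurable
  have self: "expected_time_from M X i (mixing_time 0 X (\<lambda>_. i)) = 0"
  proof -
    have "expected_time_from M X i (mixing_time 0 X (\<lambda>_. i)) = expected_time_from M X i (\<lambda>_. 0)"
      by (rule expected_time_from_cong, rule E, simp add: mixing_time_0_eq_0)
    then show ?thesis by (simp add: expected_time_from_def)
  qed
  have other: "expected_time_from M X i (mixing_time 0 X (\<lambda>_. j)) = mean_first_passage M X i j"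
    if "j \<noteq> i" for j
    unfolding mean_first_passage_def first_passage_time_eq_mixing_time
    by (rule expected_time_from_cong, rule E) (use that in \<open>simp add: mixing_time_0_eq_mixing_time_1\<close>)
  have "expected_time_from M X i (mixing_time 0 X Y)
      = (\<Sum>j\<in>{1..m} - {i}. ennreal (\<pi> j) * expected_time_from M X i (mixing_time 0 X (\<lambda>_. j)))"
    \<comment> \<open>The term \<open>j = i\<close> drops out because a chain started in
      \<open>i\<close> hits \<open>i\<close> at step 0.\<close>
    unfolding mix using self by (intro sum.mono_neutral_right) auto
  also have "\<dots> = (\<Sum>j\<in>{1..m} - {i}. ennreal (\<pi> j) * mean_first_passage M X i j)"
    by (intro sum.cong refl) (simp add: other)
  finally show ?thesis
    \<comment> \<open>Counting from step 1, every constant-target time is a first passage time; the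
      term \<open>j = i\<close> stays and carries the mean recurrence time of
      \<open>i\<close>.\<close>
    using mix[of i 1] by (simp add: mean_first_passage_def first_passage_time_eq_mixing_time)
qed

end
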